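(* For every prime $p$ and every integer $e\geq 1$ there exist a $\lambda$-ring $A$ and an element $a\in A$ such that $p^e a=0$ but $a^{p^e+p^{e-1}-1}\neq 0$.
   Context: A $\lambda$-ring is meant in the standard sense (a commutative ring with unit with $\lambda$-operations satisfying all the usual identities, sometimes called a special $\lambda$-ring). Equivalently, it is a commutative ring $A$ equipped, for each prime $q$, with a map $\theta^q\colon A\to A$ such that $\psi^q(a)=a^q-q\theta^q(a)$ defines a ring homomorphism $\psi^q\colon A\to A$ (the Adams operation), such that for all $a,b\in A$: $\theta^q(1)=0$; $\theta^q(a+b)=\theta^q(a)+\theta^q(b)+\sum_{j=1}^{q-1}\frac{1}{q}\binom{q}{j}a^jb^{q-j}$; $\theta^q(ab)=\theta^q(a)\psi^q(b)+a^q\theta^q(b)$; $\theta^q\psi^q(a)=\psi^q\theta^q(a)$; and such that $\psi^q$ and $\theta^r$ commute also for distinct primes $q\neq r$. *)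

theory Defs
  imports "HOL-Algebra.Ring" "HOL-Computational_Algebra.Primes"
begin

definition adams :: "('a, 'm) ring_scheme \<Rightarrow> (nat \<Rightarrow> 'a \<Rightarrow> 'a) \<Rightarrow> nat \<Rightarrow> 'a \<Rightarrow> 'a" where
  "adams A \<theta> q a = a [^]\<^bsub>A\<^esub> q \<ominus>\<^bsub>A\<^esub> ([q] \<cdot>\<^bsub>A\<^esub> \<theta> q a)"

text \<open>
  A (special) \<open>\<lambda>\<close>-ring, presented by the operations \<open>\<theta> q\<close> attached to the primes \<open>q\<close> (so the values
  of \<open>\<theta>\<close> at non-primes are irrelevant). For \<open>q\<close> prime and \<open>0 < j < q\<close>, the natural-number quotient
  \<open>(q choose j) div q\<close> is exact. The zero ring is not excluded.
  Asking for one element of some \<open>\<lambda>\<close>-ring with given torsion and powers loses nothing when carriers are taken inside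
  \<open>nat\<close>: the subset generated by that element under the ring operations and all \<open>\<theta> q\<close> is a countable
  \<open>\<lambda>\<close>-ring.
\<close>

locale lambda_ring = cring A for A (structure) +
  fixes \<theta> :: "nat \<Rightarrow> 'a \<Rightarrow> 'a"
  assumes theta_closed: "\<lbrakk>prime q; a \<in> carrier A\<rbrakk> \<Longrightarrow> \<theta> q a \<in> carrier A"
    and adams_hom: "prime q \<Longrightarrow> adams A \<theta> q \<in> ring_hom A A"
    and theta_one: "prime q \<Longrightarrow> \<theta> q \<one> = \<zero>"
    and theta_add: "\<lbrakk>prime q; a \<in> carrier A; b \<in> carrier A\<rbrakk> \<Longrightarrow>
      \<theta> q (a \<oplus> b) = \<theta> q a \<oplus> \<theta> q b
        \<oplus> (\<Oplus>j\<in>{1..q - 1}. [((q choose j) div q)] \<cdot> (a [^] j \<otimes> b [^] (q - j)))"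
    and theta_mult: "\<lbrakk>prime q; a \<in> carrier A; b \<in> carrier A\<rbrakk> \<Longrightarrow>
      \<theta> q (a \<otimes> b) = \<theta> q a \<otimes> adams A \<theta> q b \<oplus> a [^] q \<otimes> \<theta> q b"
    and theta_adams: "\<lbrakk>prime q; a \<in> carrier A\<rbrakk> \<Longrightarrow>
      \<theta> q (adams A \<theta> q a) = adams A \<theta> q (\<theta> q a)"
    and adams_theta_commute: "\<lbrakk>prime q; prime r; q \<noteq> r; a \<in> carrier A\<rbrakk> \<Longrightarrow>
      adams A \<theta> q (\<theta> r a) = \<theta> r (adams A \<theta> q a)"

end

theory Submission
  imports Defs "HOL-Computational_Algebra.Polynomial" "HOL-Library.Countable_Set"
begin

text \<open>
  Over \<open>\<int>\<^bsub>(p)\<^esub>\<close> all primes \<open>q \<noteq> p\<close> are invertible, so \<open>\<psi>\<^sup>q = id\<close> is admissible for them and only a lift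
  \<open>\<Psi>\<close> of the \<open>p\<close>-th power Frobenius has to be chosen. On \<open>B = \<int>\<^bsub>(p)\<^esub>[X, Y]\<close> take \<open>\<Psi> X = X\<^sup>p + p Y\<close> and
  \<open>\<Psi> Y = Y\<^sup>p\<close>. If \<open>p\<^sup>m b\<close> lies in a \<open>\<theta>\<close>-stable ideal, then so does \<open>p\<^sup>m\<^sup>-\<^sup>1 \<Psi> b\<close>; hence the \<open>\<theta>\<close>-stable ideal
  generated by \<open>p\<^sup>e X\<close> contains \<open>p\<^sup>e\<^sup>-\<^sup>k \<Psi>\<^sup>k X\<close> for \<open>k \<le> e\<close> and finally \<open>\<theta> (\<Psi>\<^sup>e X) = - \<Psi>\<^sup>e Y\<close>, a power of \<open>Y\<close>;
  these elements already generate a \<open>\<theta>\<close>-stable ideal \<open>I\<close>. Modulo \<open>p\<^sup>2\<close>, \<open>\<Psi>\<^sup>k X\<close> is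
  \<open>X ^ (p ^ k) + p Y ^ (p ^ (k - 1))\<close>, so in \<open>B / I\<close> the power in question reduces to
  \<open>- p X ^ (p ^ (e - 1) - 1) Y ^ (p ^ (e - 1))\<close>, which a linear functional modulo \<open>p\<^sup>2\<close> shows to be nonzero.
\<close>

section \<open>Quotients of rings with commuting Adams operations\<close>

text \<open>The middle binomial coefficients are divisible by the prime q, so the quotients are
  exact and the sum is the correction term in the axiom for \<theta> of a sum.\<close>

lemma binomial_prime:
  fixes a b :: "'r::comm_ring_1"
  assumes "prime q"
  shows "(a + b) ^ q = a ^ q + b ^ q
    + of_nat q * (\<Sum>j\<in>{1..q - 1}. of_nat ((q choose j) div q) * (a ^ j * b ^ (q - j)))"
proof -
  have q: "q \<ge> 2" using assms by (rule prime_ge_2_nat)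
  have dec: "{..q} = insert 0 (insert q {1..q - 1})" using q by auto
  have "(a + b) ^ q = (\<Sum>j\<in>{..q}. of_nat (q choose j) * a ^ j * b ^ (q - j))"
    by (rule binomial_ring)
  also have "\<dots> = b ^ q + (a ^ q + (\<Sum>j\<in>{1..q - 1}. of_nat (q choose j) * a ^ j * b ^ (q - j)))"
    unfolding dec using q by (subst sum.insert; auto)+
  also have "(\<Sum>j\<in>{1..q - 1}. of_nat (q choose j) * a ^ j * b ^ (q - j)) =
     of_nat q * (\<Sum>j\<in>{1..q - 1}. of_nat ((q choose j) div q) * (a ^ j * b ^ (q - j)))"
    unfolding sum_distrib_left
  proof (rule sum.cong)
    fix j assume "j \<in> {1..q - 1}"
    then have "q choose j = q * ((q choose j) div q)" using dvd_choose_prime[of j q] assms q by auto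
    then have "(of_nat (q choose j) :: 'r) = of_nat q * of_nat ((q choose j) div q)"
      by (metis of_nat_mult)
    then show "of_nat (q choose j) * a ^ j * b ^ (q - j) =
      of_nat q * (of_nat ((q choose j) div q) * (a ^ j * b ^ (q - j)))"
      by (simp add: algebra_simps)
  qed simp
  finally show ?thesis by (simp add: algebra_simps)
qed

text \<open>Each prime q has the inverse \<open>c q\<close> in the ambient ring, so
  \<open>th\<close> below is an explicit formula and its axioms are identities. Integrality is
  handled separately, by passing to a subring.\<close>

locale adams_system =
  fixes c :: "nat \<Rightarrow> 'r::comm_ring_1" and \<psi> :: "nat \<Rightarrow> 'r \<Rightarrow> 'r"
  assumes c: "prime q \<Longrightarrow> of_nat q * c q = 1"
    and \<psi>_one: "\<psi> q 1 = 1"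
    and \<psi>_add: "\<psi> q (f + g) = \<psi> q f + \<psi> q g"
    and \<psi>_mult: "\<psi> q (f * g) = \<psi> q f * \<psi> q g"
    and \<psi>_commute: "\<psi> q (\<psi> r f) = \<psi> r (\<psi> q f)"
begin

definition th :: "nat \<Rightarrow> 'r \<Rightarrow> 'r" where
  "th q f = c q * (f ^ q - \<psi> q f)"

lemma \<psi>_zero: "\<psi> q 0 = 0"
  using \<psi>_add[of q 0 0] by simp

lemma \<psi>_diff: "\<psi> q (f - g) = \<psi> q f - \<psi> q g"
  using \<psi>_add[of q "f - g" g] by simp

lemma \<psi>_power: "\<psi> q (f ^ n) = \<psi> q f ^ n"
  by (induction n) (simp_all add: \<psi>_one \<psi>_mult)

lemma \<psi>_of_nat: "\<psi> q (of_nat n) = of_nat n"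
  by (induction n) (simp_all add: \<psi>_zero \<psi>_one \<psi>_add)

lemma \<psi>_c: "prime r \<Longrightarrow> \<psi> q (c r) = c r"
proof -
  assume r: "prime r"
  have "of_nat r * \<psi> q (c r) = \<psi> q (of_nat r * c r)" by (simp only: \<psi>_mult \<psi>_of_nat)
  then have "of_nat r * \<psi> q (c r) = 1" using c[OF r] by (simp add: \<psi>_one)
  then have "c r * (of_nat r * \<psi> q (c r)) = c r" by simp
  then show ?thesis using c[OF r] by (metis mult.assoc mult.commute mult_1)
qed

lemma of_nat_th: "prime q \<Longrightarrow> of_nat q * th q f = f ^ q - \<psi> q f"
  unfolding th_def by (metis c mult.assoc mult_1)

text \<open>As q is invertible, an identity for \<open>th q\<close> may be checked after
  multiplication by q.\<close>

lemma th_eqI: "prime q \<Longrightarrow> of_nat q * g = f ^ q - \<psi> q f \<Longrightarrow> th q f = g"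
  unfolding th_def by (metis c mult.assoc mult.commute mult_1)

lemma th_one: "prime q \<Longrightarrow> th q 1 = 0"
  by (rule th_eqI) (simp_all add: \<psi>_one)

lemma th_add: "prime q \<Longrightarrow> th q (f + g) = th q f + th q g
    + (\<Sum>j\<in>{1..q - 1}. of_nat ((q choose j) div q) * (f ^ j * g ^ (q - j)))"
  by (rule th_eqI) (simp_all add: distrib_left of_nat_th binomial_prime \<psi>_add)

lemma th_mult: "prime q \<Longrightarrow> th q (f * g) = th q f * \<psi> q g + f ^ q * th q g"
proof (rule th_eqI)
  assume q: "prime q"
  have "of_nat q * (th q f * \<psi> q g + f ^ q * th q g)
     = (of_nat q * th q f) * \<psi> q g + f ^ q * (of_nat q * th q g)"
    by (simp add: algebra_simps)
  then show "of_nat q * (th q f * \<psi> q g + f ^ q * th q g) = (f * g) ^ q - \<psi> q (f * g)"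
    by (simp add: of_nat_th[OF q] \<psi>_mult algebra_simps)
qed

text \<open>The endomorphism \<open>\<psi> r\<close> fixes the constant \<open>c q\<close> and
  commutes with \<open>\<psi> q\<close>. Taking r equal to q or distinct from it yields both
  commutation axioms.\<close>

lemma th_\<psi>: "prime q \<Longrightarrow> th q (\<psi> r f) = \<psi> r (th q f)"
  unfolding th_def by (simp add: \<psi>_mult \<psi>_diff \<psi>_power \<psi>_c \<psi>_commute[of q r])

end

section \<open>Subrings and ideals stable under \<open>th\<close>\<close>

locale adams_subring = adams_system c \<psi>
  for c :: "nat \<Rightarrow> 'r::comm_ring_1" and \<psi> +
  fixes B :: "'r set"
  assumes one_B: "1 \<in> B"
    and diff_B: "f \<in> B \<Longrightarrow> g \<in> B \<Longrightarrow> f - g \<in> B"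
    and mult_B: "f \<in> B \<Longrightarrow> g \<in> B \<Longrightarrow> f * g \<in> B"
begin

lemma zero_B: "0 \<in> B"
  using diff_B[OF one_B one_B] by simp

lemma minus_B: "f \<in> B \<Longrightarrow> - f \<in> B"
  using diff_B[OF zero_B] by simp

lemma add_B: "f \<in> B \<Longrightarrow> g \<in> B \<Longrightarrow> f + g \<in> B"
  using diff_B[of f "- g"] minus_B by simp

lemma power_B: "f \<in> B \<Longrightarrow> f ^ n \<in> B"
  by (induction n) (auto intro: one_B mult_B)

lemma of_nat_B: "of_nat n \<in> B"
  by (induction n) (auto intro: zero_B one_B add_B)

lemma sum_B: "(\<And>i. i \<in> S \<Longrightarrow> g i \<in> B) \<Longrightarrow> sum g S \<in> B"
  by (induction S rule: infinite_finite_induct) (auto intro: zero_B add_B)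

lemma \<psi>_B:
  assumes "prime q" "f \<in> B" "th q f \<in> B"
  shows "\<psi> q f \<in> B"
proof -
  have "\<psi> q f = f ^ q - of_nat q * th q f" using of_nat_th[OF assms(1)] by simp
  then show ?thesis using assms by (simp add: diff_B power_B mult_B of_nat_B)
qed

end

locale adams_quotient = adams_subring c \<psi> B
  for c :: "nat \<Rightarrow> 'r::comm_ring_1" and \<psi> B +
  fixes I :: "'r set"
  assumes countable_B: "countable B"
    and th_B: "prime q \<Longrightarrow> f \<in> B \<Longrightarrow> th q f \<in> B"
    and I_subset: "I \<subseteq> B"
    and zero_I: "0 \<in> I"
    and add_I: "f \<in> I \<Longrightarrow> g \<in> I \<Longrightarrow> f + g \<in> I"
    and mult_I: "f \<in> B \<Longrightarrow> g \<in> I \<Longrightarrow> f * g \<in> I"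
    and th_I: "prime q \<Longrightarrow> f \<in> I \<Longrightarrow> th q f \<in> I"
begin

lemma sum_I: "(\<And>i. i \<in> S \<Longrightarrow> g i \<in> I) \<Longrightarrow> sum g S \<in> I"
  by (induction S rule: infinite_finite_induct) (auto intro: zero_I add_I)

lemma diff_I: "f \<in> I \<Longrightarrow> g \<in> I \<Longrightarrow> f - g \<in> I"
  using add_I[of f "- g"] mult_I[of "- 1" g] minus_B[OF one_B] by simp

text \<open>In the expansion of \<open>th q (g + (f - g))\<close> every correction term contains a
  positive power of f - g, hence lies in the ideal. So \<open>th q\<close> descends to
  cosets.\<close>

lemma th_cong:
  assumes q: "prime q" and f: "f \<in> B" and g: "g \<in> B" and fg: "f - g \<in> I"
  shows "th q f - th q g \<in> I"
proof -
  have "th q (g + (f - g)) = th q g + th q (f - g)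
     + (\<Sum>j\<in>{1..q - 1}. of_nat ((q choose j) div q) * (g ^ j * (f - g) ^ (q - j)))"
    by (rule th_add[OF q])
  moreover have "(\<Sum>j\<in>{1..q - 1}. of_nat ((q choose j) div q) * (g ^ j * (f - g) ^ (q - j))) \<in> I"
  proof (intro sum_I mult_I of_nat_B power_B g)
    fix j assume "j \<in> {1..q - 1}"
    then obtain k where "q - j = Suc k" by (cases "q - j") auto
    then show "(f - g) ^ (q - j) \<in> I"
      using mult_I[OF power_B[OF diff_B[OF f g], of k] fg] by (simp add: mult.commute)
  qed
  ultimately show ?thesis using add_I[OF th_I[OF q fg]] by (simp add: add.assoc)
qed

text \<open>The carrier has to consist of natural numbers, so a coset is encoded by the number of a
  chosen representative; the choice depends only on the coset.\<close>

definition cls :: "'r \<Rightarrow> nat" where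
  "cls f = to_nat_on B (SOME g. g \<in> B \<and> g - f \<in> I)"

lemma cls_eq_iff:
  assumes "f \<in> B" "g \<in> B"
  shows "cls f = cls g \<longleftrightarrow> f - g \<in> I"
proof
  define R where "R f = (SOME h. h \<in> B \<and> h - f \<in> I)" for f
  have R: "R f \<in> B" "R f - f \<in> I" if "f \<in> B" for f
    using someI[of "\<lambda>h. h \<in> B \<and> h - f \<in> I" f] that zero_I unfolding R_def by auto
  assume "cls f = cls g"
  then have "to_nat_on B (R f) = to_nat_on B (R g)" unfolding cls_def R_def .
  then have eq: "R f = R g" using inj_on_to_nat_on[OF countable_B] R assms by (meson inj_onD)
  have "(R g - g) - (R f - f) \<in> I" by (intro diff_I R assms)
  then show "f - g \<in> I" using eq by simp
next
  assume fg: "f - g \<in> I"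
  have "h - f \<in> I \<longleftrightarrow> h - g \<in> I" for h
  proof
    assume "h - f \<in> I"
    from add_I[OF this fg] show "h - g \<in> I" by simp
  next
    assume "h - g \<in> I"
    from diff_I[OF this fg] show "h - f \<in> I" by simp
  qed
  then show "cls f = cls g" unfolding cls_def by simp
qed

definition rep :: "nat \<Rightarrow> 'r" where
  "rep = inv_into B cls"

lemma rep_cls:
  assumes "f \<in> B"
  shows "rep (cls f) \<in> B" "rep (cls f) - f \<in> I"
proof -
  show B: "rep (cls f) \<in> B" unfolding rep_def by (intro inv_into_into imageI assms)
  have "cls (rep (cls f)) = cls f" unfolding rep_def by (intro f_inv_into_f imageI assms)
  then show "rep (cls f) - f \<in> I" using cls_eq_iff[OF B assms] by simp
qed

section \<open>The quotient as a \<lambda>-ring on natural numbers\<close>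

definition Q :: "nat ring" where
  "Q = \<lparr>carrier = cls ` B, monoid.mult = (\<lambda>m n. cls (rep m * rep n)), one = cls 1,
        zero = cls 0, add = (\<lambda>m n. cls (rep m + rep n))\<rparr>"

definition thQ :: "nat \<Rightarrow> nat \<Rightarrow> nat" where
  "thQ q m = cls (th q (rep m))"

lemma carrier_Q: "carrier Q = cls ` B" by (simp add: Q_def)
lemma one_Q: "\<one>\<^bsub>Q\<^esub> = cls 1" by (simp add: Q_def)
lemma zero_Q: "\<zero>\<^bsub>Q\<^esub> = cls 0" by (simp add: Q_def)

lemma mult_Q:
  assumes "f \<in> B" "g \<in> B"
  shows "cls f \<otimes>\<^bsub>Q\<^esub> cls g = cls (f * g)"
proof -
  \<comment> \<open>With representatives u of f and v of g this is u v - f g = u (v - g) + g (u -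
    f).\<close>
  have "rep (cls f) * (rep (cls g) - g) + g * (rep (cls f) - f) \<in> I"
    using assms by (intro add_I mult_I rep_cls)
  then have "rep (cls f) * rep (cls g) - f * g \<in> I" by (simp add: algebra_simps)
  then have "cls (rep (cls f) * rep (cls g)) = cls (f * g)"
    using assms by (subst cls_eq_iff) (auto intro: mult_B rep_cls)
  then show ?thesis by (simp add: Q_def)
qed

lemma add_Q:
  assumes "f \<in> B" "g \<in> B"
  shows "cls f \<oplus>\<^bsub>Q\<^esub> cls g = cls (f + g)"
proof -
  have "(rep (cls f) - f) + (rep (cls g) - g) \<in> I"
    using assms by (intro add_I rep_cls)
  then have "rep (cls f) + rep (cls g) - (f + g) \<in> I" by (simp add: algebra_simps)
  then have "cls (rep (cls f) + rep (cls g)) = cls (f + g)"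
    using assms by (subst cls_eq_iff) (auto intro: add_B rep_cls)
  then show ?thesis by (simp add: Q_def)
qed

lemma thQ_cls: "prime q \<Longrightarrow> f \<in> B \<Longrightarrow> thQ q (cls f) = cls (th q f)"
  unfolding thQ_def by (subst cls_eq_iff) (auto intro: th_B rep_cls th_cong)

lemma cring_Q: "cring Q"
proof (intro cringI abelian_groupI comm_monoidI)
  fix x assume "x \<in> carrier Q"
  then obtain f where f: "f \<in> B" "x = cls f" by (auto simp: carrier_Q)
  show "\<exists>y\<in>carrier Q. y \<oplus>\<^bsub>Q\<^esub> x = \<zero>\<^bsub>Q\<^esub>"
    by (rule bexI[of _ "cls (- f)"]) (use f in \<open>auto simp: add_Q zero_Q minus_B carrier_Q\<close>)
qed (auto simp: carrier_Q add_Q mult_Q one_Q zero_Q add_B mult_B zero_B one_B algebra_simps)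

sublocale Q: cring Q by (rule cring_Q)

lemma pow_Q: "f \<in> B \<Longrightarrow> cls f [^]\<^bsub>Q\<^esub> (n::nat) = cls (f ^ n)"
  by (induction n) (auto simp: one_Q mult_Q power_B mult.commute)

lemma minus_Q:
  assumes "f \<in> B" "g \<in> B"
  shows "cls f \<ominus>\<^bsub>Q\<^esub> cls g = cls (f - g)"
proof -
  have "\<ominus>\<^bsub>Q\<^esub> cls g = cls (- g)"
    by (rule Q.minus_equality) (use assms in \<open>auto simp: add_Q zero_Q minus_B carrier_Q\<close>)
  then show ?thesis using assms by (simp add: a_minus_def add_Q minus_B)
qed

lemma add_pow_Q: "f \<in> B \<Longrightarrow> [(n::nat)] \<cdot>\<^bsub>Q\<^esub> cls f = cls (of_nat n * f)"
  by (induction n) (auto simp: zero_Q add_Q mult_B of_nat_B algebra_simps)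

lemma finsum_Q:
  assumes "finite S" "\<And>i. i \<in> S \<Longrightarrow> g i \<in> B"
  shows "finsum Q (\<lambda>i. cls (g i)) S = cls (sum g S)"
  using assms
proof (induction S rule: finite_induct)
  case (insert i S)
  then show ?case by (subst Q.finsum_insert) (auto simp: carrier_Q add_Q sum_B)
qed (auto simp: zero_Q)

lemma adams_Q: "prime q \<Longrightarrow> f \<in> B \<Longrightarrow> adams Q thQ q (cls f) = cls (\<psi> q f)"
  unfolding adams_def
  by (simp add: thQ_cls pow_Q add_pow_Q minus_Q power_B mult_B of_nat_B th_B)
    (simp add: of_nat_th)

lemma lambda_ring_Q: "lambda_ring Q thQ"
proof unfold_locales
  fix q r :: nat and a b
  assume q: "prime q"
  show "thQ q \<one>\<^bsub>Q\<^esub> = \<zero>\<^bsub>Q\<^esub>"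
    by (simp add: one_Q zero_Q thQ_cls q one_B th_one)
  show "adams Q thQ q \<in> ring_hom Q Q"
    by (rule ring_hom_memI)
      (auto simp: carrier_Q adams_Q q mult_Q add_Q one_Q \<psi>_B th_B \<psi>_mult \<psi>_add \<psi>_one mult_B add_B one_B)
  assume "a \<in> carrier Q"
  then obtain f where f: "f \<in> B" "a = cls f" by (auto simp: carrier_Q)
  show "thQ q a \<in> carrier Q" by (simp add: carrier_Q f thQ_cls q th_B)
  show "thQ q (adams Q thQ q a) = adams Q thQ q (thQ q a)"
    by (simp add: f thQ_cls adams_Q q th_B \<psi>_B th_\<psi>)
  { assume "prime r"
    then show "adams Q thQ q (thQ r a) = thQ r (adams Q thQ q a)"
      by (simp add: f thQ_cls adams_Q q th_B \<psi>_B th_\<psi>) }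
  assume "b \<in> carrier Q"
  then obtain g where g: "g \<in> B" "b = cls g" by (auto simp: carrier_Q)
  show "thQ q (a \<otimes>\<^bsub>Q\<^esub> b) = thQ q a \<otimes>\<^bsub>Q\<^esub> adams Q thQ q b \<oplus>\<^bsub>Q\<^esub> a [^]\<^bsub>Q\<^esub> q \<otimes>\<^bsub>Q\<^esub> thQ q b"
    by (simp add: f g thQ_cls adams_Q q th_B \<psi>_B mult_Q add_Q mult_B th_mult pow_Q power_B)
  have "(\<Oplus>\<^bsub>Q\<^esub>j\<in>{1..q - 1}. [((q choose j) div q)] \<cdot>\<^bsub>Q\<^esub> (a [^]\<^bsub>Q\<^esub> j \<otimes>\<^bsub>Q\<^esub> b [^]\<^bsub>Q\<^esub> (q - j)))
     = cls (\<Sum>j\<in>{1..q - 1}. of_nat ((q choose j) div q) * (f ^ j * g ^ (q - j)))"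
    by (simp add: f g pow_Q mult_Q power_B mult_B add_pow_Q finsum_Q of_nat_B)
  then show "thQ q (a \<oplus>\<^bsub>Q\<^esub> b) = thQ q a \<oplus>\<^bsub>Q\<^esub> thQ q b \<oplus>\<^bsub>Q\<^esub>
       (\<Oplus>\<^bsub>Q\<^esub>j\<in>{1..q - 1}. [((q choose j) div q)] \<cdot>\<^bsub>Q\<^esub> (a [^]\<^bsub>Q\<^esub> j \<otimes>\<^bsub>Q\<^esub> b [^]\<^bsub>Q\<^esub> (q - j)))"
    by (simp add: f g thQ_cls q th_B add_Q add_B th_add sum_B mult_B power_B of_nat_B)
qed

text \<open>Turns torsion and nonvanishing of a power in the quotient into membership questions
  about the ideal.\<close>

lemma quotient_lambda_ring:
  assumes "a \<in> B" "of_nat m * a \<in> I" "a ^ n \<notin> I"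
  shows "\<exists>(A :: nat ring) \<theta> a. lambda_ring A \<theta> \<and> a \<in> carrier A \<and>
    [m] \<cdot>\<^bsub>A\<^esub> a = \<zero>\<^bsub>A\<^esub> \<and> a [^]\<^bsub>A\<^esub> n \<noteq> \<zero>\<^bsub>A\<^esub>"
proof (intro exI conjI)
  show "lambda_ring Q thQ" by (rule lambda_ring_Q)
  show "cls a \<in> carrier Q" using assms by (simp add: carrier_Q)
  show "[m] \<cdot>\<^bsub>Q\<^esub> cls a = \<zero>\<^bsub>Q\<^esub>"
    using assms by (simp add: add_pow_Q zero_Q cls_eq_iff mult_B of_nat_B zero_B)
  show "cls a [^]\<^bsub>Q\<^esub> n \<noteq> \<zero>\<^bsub>Q\<^esub>"
    using assms by (simp add: pow_Q zero_Q cls_eq_iff power_B zero_B)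
qed

end

section \<open>A twisted Frobenius lift on polynomials in two variables\<close>

text \<open>\<open>X\<close> is the outer and \<open>Y\<close> the inner variable:
  \<open>coeff (coeff f i) j\<close> is the coefficient of X^i Y^j.\<close>

definition X :: "rat poly poly" where "X = [:0, 1:]"
definition Y :: "rat poly poly" where "Y = [:[:0, 1:]:]"

lemma X_power_eq: "X ^ n = monom 1 n"
  by (simp add: X_def monom_altdef)

lemma Y_power_eq: "Y ^ n = [:monom 1 n:]"
  by (induction n) (simp_all add: Y_def one_pCons monom_0 monom_Suc)

locale twisted_frobenius =
  fixes p :: nat
  assumes prime_p: "prime p"
begin

text \<open>The action of \<Psi> on coefficients, substituting Y^p for Y; evaluation at the image of
  X then extends it.\<close>

definition lift_Y :: "rat poly \<Rightarrow> rat poly poly" where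
  "lift_Y a = [:pcompose a (monom 1 p):]"

definition \<Psi> :: "rat poly poly \<Rightarrow> rat poly poly" where
  "\<Psi> f = poly (map_poly lift_Y f) (X ^ p + of_nat p * Y)"

lemma \<Psi>_pCons: "\<Psi> (pCons a f) = lift_Y a + (X ^ p + of_nat p * Y) * \<Psi> f"
  by (simp add: \<Psi>_def map_poly_pCons lift_Y_def)

lemma \<Psi>_0: "\<Psi> 0 = 0"
  by (simp add: \<Psi>_def)

lemma lift_Y_add: "lift_Y (a + b) = lift_Y a + lift_Y b"
  by (simp add: lift_Y_def pcompose_add)

lemma lift_Y_mult: "lift_Y (a * b) = lift_Y a * lift_Y b"
  by (simp add: lift_Y_def pcompose_mult)

lemma \<Psi>_add: "\<Psi> (f + g) = \<Psi> f + \<Psi> g"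
  by (induction f g rule: poly_induct2) (simp_all add: \<Psi>_0 \<Psi>_pCons lift_Y_add algebra_simps)

lemma \<Psi>_smult: "\<Psi> (smult a f) = lift_Y a * \<Psi> f"
  by (induction f) (simp_all add: \<Psi>_0 \<Psi>_pCons lift_Y_mult algebra_simps)

lemma \<Psi>_mult: "\<Psi> (f * g) = \<Psi> f * \<Psi> g"
proof (induction f)
  case (pCons a f)
  then show ?case
    by (simp add: \<Psi>_pCons \<Psi>_add \<Psi>_smult lift_Y_def[of 0] algebra_simps)
qed (simp add: \<Psi>_0)

lemma \<Psi>_1: "\<Psi> 1 = 1"
  by (simp add: one_pCons \<Psi>_pCons \<Psi>_0 lift_Y_def)

lemma \<Psi>_X: "\<Psi> X = X ^ p + of_nat p * Y"
  using \<Psi>_1 by (simp add: X_def \<Psi>_pCons \<Psi>_0 lift_Y_def pcompose_1 del: mult_pCons_left)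

lemma \<Psi>_Y: "\<Psi> Y = Y ^ p"
  by (simp add: Y_power_eq) (simp add: Y_def \<Psi>_pCons \<Psi>_0 lift_Y_def pcompose_pCons)

definition \<psi> :: "nat \<Rightarrow> rat poly poly \<Rightarrow> rat poly poly" where
  "\<psi> q = (if q = p then \<Psi> else id)"

definition c :: "nat \<Rightarrow> rat poly poly" where
  "c n = [:[:1 / of_nat n:]:]"

lemma of_nat_c: "n \<noteq> 0 \<Longrightarrow> of_nat n * c n = 1"
  by (simp add: c_def of_nat_poly one_pCons)

sublocale adams_system c \<psi>
  by unfold_locales
    (auto simp: \<psi>_def \<Psi>_add \<Psi>_mult \<Psi>_1 intro!: of_nat_c dest: prime_gt_0_nat)

text \<open>\<open>B\<close> is \<open>\<int>\<^bsub>(p)\<^esub>[X, Y]\<close>; the elements \<open>c n\<close> supply the constants \<open>1 / n\<close>.\<close>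
inductive_set B :: "rat poly poly set" where
  inverse: "coprime n p \<Longrightarrow> c n \<in> B"
| minus_one: "- 1 \<in> B"
| X: "X \<in> B"
| Y: "Y \<in> B"
| add: "f \<in> B \<Longrightarrow> g \<in> B \<Longrightarrow> f + g \<in> B"
| mult: "f \<in> B \<Longrightarrow> g \<in> B \<Longrightarrow> f * g \<in> B"

sublocale adams_subring c \<psi> B
proof unfold_locales
  show "1 \<in> B" using B.inverse[of 1] by (simp add: c_def one_pCons)
  show "f - g \<in> B" if "f \<in> B" "g \<in> B" for f g
    using B.add[OF that(1) B.mult[OF B.minus_one that(2)]] by simp
qed (rule B.mult)

section \<open>Stability of \<open>B\<close> under all \<open>th q\<close>\<close>

lemma th_zero: "th p 0 = 0"
  by (rule th_eqI) (use prime_p \<psi>_zero in \<open>auto dest: prime_gt_0_nat\<close>)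

lemma th_X: "th p X = - Y"
  by (rule th_eqI) (use prime_p in \<open>simp_all add: \<psi>_def \<Psi>_X\<close>)

lemma th_Y: "th p Y = 0"
  by (rule th_eqI) (use prime_p in \<open>simp_all add: \<psi>_def \<Psi>_Y\<close>)

lemma th_other: "q \<noteq> p \<Longrightarrow> th q f = c q * (f ^ q - f)"
  by (simp add: th_def \<psi>_def)

text \<open>The additivity defect of \<open>th p\<close> is an integral polynomial in f and g, so
  stability passes to sums and differences.\<close>

lemma th_sum_B:
  assumes "f \<in> B" "g \<in> B"
  shows "th p (f + g) - (th p f + th p g) \<in> B"
  using assms by (simp add: th_add prime_p sum_B mult_B power_B of_nat_B)

lemma th_of_nat: "th p (of_nat n) \<in> B"
proof (induction n)
  case (Suc n)
  have "th p (1 + of_nat n) - (th p 1 + th p (of_nat n)) \<in> B"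
    by (intro th_sum_B one_B of_nat_B)
  from add_B[OF this Suc] show ?case by (simp add: th_one prime_p)
qed (simp add: th_zero zero_B)

text \<open>Induction over the generators of \<open>B\<close>; the sum and product rules for
  \<open>th p\<close> carry integrality along.\<close>

lemma th_p_B: "f \<in> B \<Longrightarrow> th p f \<in> B"
proof (induction rule: B.induct)
  case (inverse n)
  have "n \<noteq> 0" using inverse prime_p by (metis coprime_0_left_iff not_prime_unit)
  then have n: "of_nat n * c n = 1" by (rule of_nat_c)
  \<comment> \<open>Applying \<open>th p\<close> to (1/n) n = 1 and solving expresses
    \<open>th p (c n)\<close> through the integral \<open>th p (of_nat n)\<close>.\<close>
  then have "th p (c n * of_nat n) = 0" by (simp add: th_one prime_p mult.commute)
  then have "th p (c n) * of_nat n + c n ^ p * th p (of_nat n) = 0"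
    by (simp add: th_mult[OF prime_p] \<psi>_of_nat)
  then have "th p (c n) * (of_nat n * c n) = - (c n ^ p * th p (of_nat n)) * c n"
    by (simp add: eq_neg_iff_add_eq_0 flip: mult.assoc distrib_right)
  then have "th p (c n) = - (c n ^ p * th p (of_nat n)) * c n" by (simp add: n)
  moreover have "\<dots> \<in> B"
    by (intro mult_B minus_B power_B th_of_nat B.inverse inverse)
  ultimately show ?case by simp
next
  case minus_one
  have "th p (1 + - 1) - (th p 1 + th p (- 1)) \<in> B"
    by (intro th_sum_B one_B B.minus_one)
  then have "- th p (- 1) \<in> B" by (simp add: th_one prime_p th_zero)
  from minus_B[OF this] show ?case by simp
next
  case X
  then show ?case by (simp only: th_X minus_B B.Y)
next
  case Y
  then show ?case by (simp only: th_Y zero_B)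
next
  case (add f g)
  then have "th p (f + g) - (th p f + th p g) + (th p f + th p g) \<in> B"
    by (intro add_B th_sum_B)
  then show ?case by simp
next
  case (mult f g)
  then show ?case by (simp add: th_mult prime_p add_B mult_B power_B \<psi>_B)
qed

lemma c_prime_B: "prime q \<Longrightarrow> q \<noteq> p \<Longrightarrow> c q \<in> B"
  by (intro B.inverse primes_coprime prime_p)

text \<open>For q distinct from p the Adams operation is the identity and 1/q already lies in
  \<open>B\<close>.\<close>

lemma th_B:
  assumes "prime q" "f \<in> B"
  shows "th q f \<in> B"
proof (cases "q = p")
  case False
  then show ?thesis using assms by (simp add: th_other mult_B c_prime_B diff_B power_B)
qed (use assms th_p_B in simp)

lemma \<Psi>_B: "f \<in> B \<Longrightarrow> \<Psi> f \<in> B"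
  using \<psi>_B[OF prime_p _ th_p_B] by (simp add: \<psi>_def)

section \<open>Iterates of \<Psi> modulo p and modulo p^2\<close>

lemma funpow_\<Psi>_B: "f \<in> B \<Longrightarrow> (\<Psi> ^^ k) f \<in> B"
  by (induction k) (simp_all add: \<Psi>_B)

lemma funpow_\<Psi>_mult: "(\<Psi> ^^ k) (f * g) = (\<Psi> ^^ k) f * (\<Psi> ^^ k) g"
  by (induction k) (simp_all add: \<Psi>_mult)

lemma funpow_\<Psi>_add: "(\<Psi> ^^ k) (f + g) = (\<Psi> ^^ k) f + (\<Psi> ^^ k) g"
  by (induction k) (simp_all add: \<Psi>_add)

lemma funpow_\<Psi>_power: "(\<Psi> ^^ k) (f ^ n) = ((\<Psi> ^^ k) f) ^ n"
proof (induction n)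
  case 0
  show ?case by (induction k) (simp_all add: \<Psi>_1)
qed (simp add: funpow_\<Psi>_mult)

lemma funpow_\<Psi>_of_nat: "(\<Psi> ^^ k) (of_nat n) = of_nat n"
  by (induction k) (use \<psi>_of_nat[of p] in \<open>simp_all add: \<psi>_def\<close>)

lemma funpow_\<Psi>_Y: "(\<Psi> ^^ k) Y = Y ^ (p ^ k)"
proof (induction k)
  case (Suc k)
  have "(\<Psi> ^^ Suc k) Y = (\<Psi> ^^ k) (\<Psi> Y)" by (simp only: funpow_Suc_right o_apply)
  also have "\<dots> = (Y ^ (p ^ k)) ^ p" unfolding \<Psi>_Y funpow_\<Psi>_power Suc ..
  finally show ?case by (simp only: power_mult [symmetric] power_Suc2)
qed simp

lemma th_funpow_\<Psi>: "th p ((\<Psi> ^^ k) f) = (\<Psi> ^^ k) (th p f)"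
proof (induction k)
  case (Suc k)
  have "th p (\<Psi> g) = \<Psi> (th p g)" for g
    using th_\<psi>[OF prime_p, of p g] by (simp add: \<psi>_def)
  then show ?case by (simp add: Suc)
qed simp

text \<open>Each middle term gets one factor p from its binomial coefficient and one from p h; the
  last term has p^p, and p is at least 2.\<close>

lemma power_add_p_mult:
  assumes "f \<in> B" "h \<in> B"
  obtains h' where "h' \<in> B" "(f + of_nat p * h) ^ p = f ^ p + of_nat (p ^ 2) * h'"
proof -
  define g where "g = (\<Sum>j\<in>{1..p - 1}. of_nat ((p choose j) div p) *
    (f ^ j * (of_nat p ^ (p - j - 1) * h ^ (p - j))))"
  define h' where "h' = of_nat p ^ (p - 2) * h ^ p + g"
  have "of_nat p * g = (\<Sum>j\<in>{1..p - 1}. of_nat ((p choose j) div p) *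
    (f ^ j * (of_nat p * h) ^ (p - j)))"
    unfolding g_def sum_distrib_left
  proof (rule sum.cong)
    fix j assume "j \<in> {1..p - 1}"
    then have "p - j = Suc (p - j - 1)" by auto
    then have "(of_nat p * h) ^ (p - j) = of_nat p * (of_nat p ^ (p - j - 1) * h ^ (p - j))"
      by (metis mult.assoc power_Suc power_mult_distrib)
    then show "of_nat p * (of_nat ((p choose j) div p) *
       (f ^ j * (of_nat p ^ (p - j - 1) * h ^ (p - j)))) =
       of_nat ((p choose j) div p) * (f ^ j * (of_nat p * h) ^ (p - j))"
      by (simp only: mult_ac)
  qed simp
  then have "(f + of_nat p * h) ^ p = f ^ p + (of_nat p * h) ^ p + of_nat p * (of_nat p * g)"
    using binomial_prime[OF prime_p, of f "of_nat p * h"] by simp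
  moreover have "p = Suc (Suc (p - 2))" using prime_ge_2_nat[OF prime_p] by simp
  then have "(of_nat p * h) ^ p = of_nat p * (of_nat p * (of_nat p ^ (p - 2) * h ^ p))"
    by (metis mult.assoc power_Suc power_mult_distrib)
  ultimately have "(f + of_nat p * h) ^ p = f ^ p + of_nat (p ^ 2) * h'"
    by (simp add: h'_def power2_eq_square algebra_simps)
  moreover have "h' \<in> B"
    using assms unfolding h'_def g_def by (intro add_B sum_B mult_B power_B of_nat_B)
  ultimately show ?thesis using that by blast
qed

text \<open>Modulo p the endomorphism \<Psi> is the p-th power map on \<open>B\<close>, because
  \<Psi> g = g^p - p \<open>th p g\<close>.\<close>

lemma funpow_\<Psi>_X_mod_p: "\<exists>h\<in>B. (\<Psi> ^^ k) X = X ^ (p ^ k) + of_nat p * h"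
proof (induction k)
  case (Suc k)
  then obtain h where h: "h \<in> B" "(\<Psi> ^^ k) X = X ^ (p ^ k) + of_nat p * h" by blast
  obtain h' where h': "h' \<in> B" "(X ^ (p ^ k) + of_nat p * h) ^ p = (X ^ (p ^ k)) ^ p + of_nat (p ^ 2) * h'"
    using power_add_p_mult[OF power_B[OF B.X] h(1)] by blast
  have "(\<Psi> ^^ Suc k) X = \<Psi> ((\<Psi> ^^ k) X)" by simp
  also have "\<dots> = ((\<Psi> ^^ k) X) ^ p - of_nat p * th p ((\<Psi> ^^ k) X)"
    by (simp add: of_nat_th prime_p \<psi>_def)
  also have "\<dots> = X ^ (p ^ Suc k) + of_nat p * (of_nat p * h' - th p ((\<Psi> ^^ k) X))"
    unfolding h(2) h'(2) by (simp only: of_nat_mult power2_eq_square power_mult [symmetric]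
      power_Suc2 right_diff_distrib add_diff_eq mult.assoc)
  finally show ?case
    by (intro bexI[of _ "of_nat p * h' - th p ((\<Psi> ^^ k) X)"] diff_B mult_B of_nat_B h'
      th_p_B funpow_\<Psi>_B B.X)
qed (use zero_B in \<open>auto intro!: bexI[of _ 0]\<close>)

text \<open>Here the innermost \<Psi> is expanded first, giving (\<Psi>^k X)^p + p \<Psi>^k Y; the
  p-th power improves the congruence modulo p to one modulo p^2.\<close>

lemma funpow_\<Psi>_X_mod_p2:
  "\<exists>h\<in>B. (\<Psi> ^^ Suc k) X = X ^ (p ^ Suc k) + of_nat p * Y ^ (p ^ k) + of_nat (p ^ 2) * h"
proof -
  obtain h where h: "h \<in> B" "(\<Psi> ^^ k) X = X ^ (p ^ k) + of_nat p * h"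
    using funpow_\<Psi>_X_mod_p by blast
  obtain h' where h': "h' \<in> B" "(X ^ (p ^ k) + of_nat p * h) ^ p = (X ^ (p ^ k)) ^ p + of_nat (p ^ 2) * h'"
    using power_add_p_mult[OF power_B[OF B.X] h(1)] by blast
  have "(\<Psi> ^^ Suc k) X = (\<Psi> ^^ k) (\<Psi> X)" by (simp only: funpow_Suc_right o_apply)
  also have "\<dots> = ((\<Psi> ^^ k) X) ^ p + of_nat p * Y ^ (p ^ k)"
    unfolding \<Psi>_X funpow_\<Psi>_add funpow_\<Psi>_power funpow_\<Psi>_mult funpow_\<Psi>_of_nat funpow_\<Psi>_Y ..
  also have "\<dots> = X ^ (p ^ Suc k) + of_nat p * Y ^ (p ^ k) + of_nat (p ^ 2) * h'"
    unfolding h(2) h'(2) by (simp only: power_mult [symmetric] power_Suc2 add_ac)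
  finally show ?thesis using h' by blast
qed

section \<open>The stable ideal\<close>

text \<open>Generators come with an arbitrary factor from \<open>B\<close>, so sums alone already
  give an ideal. The power of Y is there because it is \<open>th p\<close> of the last torsion
  generator up to sign.\<close>

inductive_set I :: "nat \<Rightarrow> rat poly poly set" for e where
  torsion: "k \<le> e \<Longrightarrow> f \<in> B \<Longrightarrow> f * (of_nat (p ^ (e - k)) * (\<Psi> ^^ k) X) \<in> I e"
| Y_power: "f \<in> B \<Longrightarrow> f * Y ^ (p ^ e) \<in> I e"
| add: "f \<in> I e \<Longrightarrow> g \<in> I e \<Longrightarrow> f + g \<in> I e"

lemma I_subset_B: "I e \<subseteq> B"
proof
  fix f assume "f \<in> I e"
  then show "f \<in> B"
    by induction (simp_all only: mult_B add_B of_nat_B power_B funpow_\<Psi>_B B.X B.Y)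
qed

lemma mult_I: "f \<in> I e \<Longrightarrow> g \<in> B \<Longrightarrow> g * f \<in> I e"
proof (induction rule: I.induct)
  case (torsion k f)
  show ?case using I.torsion[OF torsion(1) mult_B[OF torsion(3,2)]] by (simp only: mult.assoc)
next
  case (Y_power f)
  show ?case using I.Y_power[OF mult_B[OF Y_power(2,1)]] by (simp only: mult.assoc)
qed (simp add: distrib_left I.add)

lemma zero_I: "0 \<in> I e"
  using I.Y_power[OF zero_B] by simp

lemma sum_I: "(\<And>i. i \<in> S \<Longrightarrow> g i \<in> I e) \<Longrightarrow> sum g S \<in> I e"
  by (induction S rule: infinite_finite_induct) (auto intro: zero_I I.add)

text \<open>Reduces stability to the generators: in the product rule, \<open>\<psi> p g\<close> =
  g^p - p \<open>th p g\<close> lies in the ideal as well.\<close>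

lemma th_mult_I:
  assumes "f \<in> B" "g \<in> I e" "th p g \<in> I e"
  shows "th p (f * g) \<in> I e"
proof -
  have "g ^ p = g ^ (p - 1) * g" using prime_gt_0_nat[OF prime_p] by (metis power_minus_mult)
  then have "\<psi> p g = g ^ (p - 1) * g + (- of_nat p) * th p g"
    by (simp add: of_nat_th prime_p)
  also have "\<dots> \<in> I e"
    using assms I_subset_B by (intro I.add mult_I power_B minus_B of_nat_B) auto
  finally show ?thesis
    unfolding th_mult[OF prime_p] using assms by (intro I.add mult_I th_p_B power_B)
qed

text \<open>Up to a multiple of the generator itself, \<open>th p\<close> sends p^(m+1) g to - p^m
  \<Psi> g, the negative of the next generator. At the end of the chain \<open>th p X\<close> = - Y
  produces the power of Y.\<close>

lemma th_torsion_generator: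
  assumes "k \<le> e"
  shows "th p (of_nat (p ^ (e - k)) * (\<Psi> ^^ k) X) \<in> I e"
proof (cases "k = e")
  case True
  have "th p ((\<Psi> ^^ e) X) = (\<Psi> ^^ e) (- 1 * Y)" by (simp add: th_funpow_\<Psi> th_X)
  also have "\<dots> = (\<Psi> ^^ e) (- 1) * Y ^ (p ^ e)" by (simp only: funpow_\<Psi>_mult funpow_\<Psi>_Y)
  also have "\<dots> \<in> I e" by (intro I.Y_power funpow_\<Psi>_B B.minus_one)
  finally show ?thesis using True by simp
next
  case False
  define m where "m = e - k - 1"
  define g where "g = (\<Psi> ^^ k) X"
  have m: "e - k = Suc m" "e - Suc k = m" "Suc k \<le> e" using assms False by (auto simp: m_def)
  obtain r where p: "p = Suc (Suc r)"
    using prime_ge_2_nat[OF prime_p] by (auto simp: numeral_2_eq_2 Suc_le_eq dest!: less_imp_Suc_add)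
  \<comment> \<open>With r = p - 2, the exponent m (r + 1) + r is (m + 1) p - 1 - (m + 1): what
    remains of (p^(m+1))^p after division by p and by p^(m+1).\<close>
  have "th p (of_nat (p ^ Suc m) * g) =
    (of_nat (p ^ (m * Suc r + r)) * g ^ Suc r) * (of_nat (p ^ Suc m) * g) + (- 1) * (of_nat (p ^ m) * \<Psi> g)"
  proof (rule th_eqI[OF prime_p])
    have "p * (p ^ (m * Suc r + r) * p ^ Suc m) = p ^ Suc (m * Suc r + r + Suc m)"
      by (simp only: power_add power_Suc)
    also have "Suc (m * Suc r + r + Suc m) = Suc m * p" by (simp add: p)
    also have "p ^ (Suc m * p) = (p ^ Suc m) ^ p" by (rule power_mult)
    finally have "(of_nat (p * (p ^ (m * Suc r + r) * p ^ Suc m)) :: rat poly poly) = of_nat ((p ^ Suc m) ^ p)"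
      by (rule arg_cong)
    then have pow: "(of_nat p * (of_nat (p ^ (m * Suc r + r)) * of_nat (p ^ Suc m)) :: rat poly poly) = of_nat (p ^ Suc m) ^ p"
      unfolding of_nat_mult of_nat_power[of "p ^ Suc m" p] .
    have "of_nat p * ((of_nat (p ^ (m * Suc r + r)) * g ^ Suc r) * (of_nat (p ^ Suc m) * g))
       = (of_nat p * (of_nat (p ^ (m * Suc r + r)) * of_nat (p ^ Suc m))) * (g ^ Suc r * g)"
      by (simp only: mult_ac)
    also have "\<dots> = of_nat (p ^ Suc m) ^ p * (g ^ Suc r * g)" by (simp only: pow)
    also have "g ^ Suc r * g = g ^ p" by (simp only: p power_Suc2)
    finally have "of_nat p * ((of_nat (p ^ (m * Suc r + r)) * g ^ Suc r) * (of_nat (p ^ Suc m) * g))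
       = (of_nat (p ^ Suc m) * g) ^ p"
      by (simp only: power_mult_distrib)
    moreover have "\<psi> p (of_nat (p ^ Suc m) * g) = of_nat p * (of_nat (p ^ m) * \<Psi> g)"
      unfolding \<psi>_mult \<psi>_of_nat by (simp add: \<psi>_def mult.assoc)
    ultimately show "of_nat p * ((of_nat (p ^ (m * Suc r + r)) * g ^ Suc r) * (of_nat (p ^ Suc m) * g) +
      (- 1) * (of_nat (p ^ m) * \<Psi> g)) = (of_nat (p ^ Suc m) * g) ^ p - \<psi> p (of_nat (p ^ Suc m) * g)"
      by (simp only: distrib_left)
  qed
  also have "\<dots> \<in> I e"
  proof (rule I.add)
    show "(of_nat (p ^ (m * Suc r + r)) * g ^ Suc r) * (of_nat (p ^ Suc m) * g) \<in> I e"
      using I.torsion[OF assms, of "of_nat (p ^ (m * Suc r + r)) * g ^ Suc r"]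
      unfolding m g_def by (simp only: mult_B of_nat_B power_B funpow_\<Psi>_B B.X)
    show "(- 1) * (of_nat (p ^ m) * \<Psi> g) \<in> I e"
      using I.torsion[OF m(3) B.minus_one] by (simp add: m g_def)
  qed
  finally show ?thesis unfolding m g_def .
qed

lemma th_Y_power: "th p (Y ^ n) = 0"
proof (induction n)
  case (Suc n)
  then show ?case unfolding power_Suc th_mult[OF prime_p] th_Y by simp
qed (simp add: th_one prime_p)

lemma th_p_I: "f \<in> I e \<Longrightarrow> th p f \<in> I e"
proof (induction rule: I.induct)
  case (torsion k f)
  have "of_nat (p ^ (e - k)) * (\<Psi> ^^ k) X \<in> I e" using I.torsion[OF torsion(1) one_B] by simp
  then show ?case by (intro th_mult_I torsion th_torsion_generator)
next
  case (Y_power f)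
  have "Y ^ (p ^ e) \<in> I e" using I.Y_power[OF one_B] by (simp only: mult_1)
  then show ?case by (intro th_mult_I Y_power) (simp_all only: th_Y_power zero_I)
next
  case (add f g)
  \<comment> \<open>Every correction term still contains a factor g, since j < p.\<close>
  have "(\<Sum>j\<in>{1..p - 1}. of_nat ((p choose j) div p) * (f ^ j * g ^ (p - j))) \<in> I e"
  proof (rule sum_I)
    fix j assume "j \<in> {1..p - 1}"
    then obtain k where "p - j = Suc k" by (cases "p - j") auto
    moreover have "of_nat ((p choose j) div p) * (f ^ j * (g ^ k * g)) \<in> I e"
      using add I_subset_B by (intro mult_I of_nat_B power_B) auto
    ultimately show "of_nat ((p choose j) div p) * (f ^ j * g ^ (p - j)) \<in> I e"
      by (simp only: power_Suc2)
  qed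
  then show ?case unfolding th_add[OF prime_p] by (intro I.add add)
qed

lemma th_I:
  assumes "prime q" "f \<in> I e"
  shows "th q f \<in> I e"
proof (cases "q = p")
  case False
  have f: "f \<in> B" using assms I_subset_B by auto
  have "f ^ q = f ^ (q - 1) * f" using prime_gt_0_nat[OF assms(1)] by (metis power_minus_mult)
  \<comment> \<open>Away from p, \<open>th q f\<close> is itself a multiple of f.\<close>
  then have "th q f = (c q * (f ^ (q - 1) - 1)) * f"
    unfolding th_other[OF False] by (simp add: algebra_simps)
  also have "\<dots> \<in> I e"
    using assms False f by (intro mult_I mult_B c_prime_B diff_B power_B one_B)
  finally show ?thesis .
qed (use assms th_p_I in simp)

text \<open>Even the whole ambient ring is countable, polynomials being images of coefficient
  lists.\<close>

lemma countable_B: "countable B"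
proof -
  have "countable (range (Poly :: rat list \<Rightarrow> rat poly))" by simp
  moreover have "surj (Poly :: rat list \<Rightarrow> rat poly)" by (metis Poly_coeffs surj_def)
  ultimately have "countable (UNIV :: rat poly set)" by simp
  then have "countable (lists (UNIV :: rat poly set))" by (rule countable_lists)
  then have "countable (range (Poly :: rat poly list \<Rightarrow> rat poly poly))" by (simp add: lists_UNIV)
  moreover have "surj (Poly :: rat poly list \<Rightarrow> rat poly poly)" by (metis Poly_coeffs surj_def)
  ultimately have "countable (UNIV :: rat poly poly set)" by simp
  then show ?thesis by (rule countable_subset[OF subset_UNIV])
qed

lemma adams_quotient: "adams_quotient c \<psi> B (I e)"
  by unfold_locales (auto intro: countable_B th_B I_subset_B[THEN subsetD] zero_I I.add mult_I th_I)

section \<open>Detecting the power\<close>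

text \<open>\<open>V\<close> is the local ring \<open>\<int>\<^bsub>(p)\<^esub>\<close>.\<close>
definition V :: "rat set" where
  "V = {r. \<exists>n. coprime n p \<and> of_nat n * r \<in> \<int>}"

lemma V_I: "coprime n p \<Longrightarrow> of_nat n * r \<in> \<int> \<Longrightarrow> r \<in> V"
  by (auto simp: V_def)

lemma Ints_V: "r \<in> \<int> \<Longrightarrow> r \<in> V"
  by (rule V_I[of 1]) auto

lemma add_V:
  assumes "r \<in> V" "s \<in> V"
  shows "r + s \<in> V"
proof -
  obtain m n where "coprime m p" "of_nat m * r \<in> \<int>" "coprime n p" "of_nat n * s \<in> \<int>"
    using assms by (auto simp: V_def)
  moreover have "of_nat (m * n) * (r + s) = of_nat n * (of_nat m * r) + of_nat m * (of_nat n * s)"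
    by (simp add: algebra_simps)
  ultimately show ?thesis by (intro V_I[of "m * n"]) (auto simp del: of_nat_mult)
qed

lemma mult_V:
  assumes "r \<in> V" "s \<in> V"
  shows "r * s \<in> V"
proof -
  obtain m n where "coprime m p" "of_nat m * r \<in> \<int>" "coprime n p" "of_nat n * s \<in> \<int>"
    using assms by (auto simp: V_def)
  moreover have "of_nat (m * n) * (r * s) = (of_nat m * r) * (of_nat n * s)"
    by (simp add: algebra_simps)
  ultimately show ?thesis
    by (intro V_I[of "m * n"]) (auto simp only: coprime_mult_left_iff intro: Ints_mult)
qed

lemma sum_V: "(\<And>i. i \<in> S \<Longrightarrow> g i \<in> V) \<Longrightarrow> sum g S \<in> V"
  by (induction S rule: infinite_finite_induct) (auto intro: add_V Ints_V)

text \<open>If n/p is an integer, then p divides n, against coprimality.\<close>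

lemma inverse_p_notin_V: "1 / of_nat p \<notin> V"
proof
  assume "1 / of_nat p \<in> V"
  then obtain n k where n: "coprime n p" "of_nat n * (1 / of_nat p) = (of_int k :: rat)"
    by (auto simp: V_def elim!: Ints_cases)
  have "(of_nat p :: rat) \<noteq> 0" using prime_gt_0_nat[OF prime_p] by simp
  with n(2) have "(of_int (int n) :: rat) = of_int (k * int p)" by (simp add: field_simps)
  then have "int n = k * int p" by (simp only: of_int_eq_iff)
  then have "p dvd n" by (metis dvd_triv_right int_dvd_int_iff)
  then have "p dvd 1" using n(1) by (metis coprime_def dvd_refl)
  then show False using prime_p by (simp add: prime_nat_iff)
qed

lemma coeff_B: "f \<in> B \<Longrightarrow> coeff (coeff f i) j \<in> V"
proof (induction arbitrary: i j rule: B.induct)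
  case (inverse n)
  then have "n \<noteq> 0" using prime_p by (metis coprime_0_left_iff not_prime_unit)
  then have "1 / of_nat n \<in> V" by (intro V_I[OF inverse]) simp
  then show ?case by (auto simp: c_def coeff_pCons intro: Ints_V split: nat.splits)
next
  case (mult f g)
  show ?case unfolding coeff_mult coeff_sum by (intro sum_V mult_V mult)
qed (auto simp: X_def Y_def coeff_pCons coeff_1 intro: Ints_V add_V split: nat.splits)

text \<open>
  The index is \<open>d = e - 1\<close>. The weight \<open>- p\<close> matches the relation \<open>X ^ (p ^ e) = - p Y ^ (p ^ d)\<close>, and \<open>p\<close> times a
  multiple of \<open>X ^ (p ^ d)\<close> misses the first monomial, so \<open>\<Lambda> d\<close> is divisible by \<open>p\<^sup>2\<close> on \<open>I e\<close>.
\<close>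
definition \<Lambda> :: "nat \<Rightarrow> rat poly poly \<Rightarrow> rat" where
  "\<Lambda> d f = coeff (coeff f (p ^ d - 1)) (p ^ d) - of_nat p * coeff (coeff f (p ^ Suc d + p ^ d - 1)) 0"

lemma \<Lambda>_add: "\<Lambda> d (f + g) = \<Lambda> d f + \<Lambda> d g"
  by (simp add: \<Lambda>_def algebra_simps)

lemma \<Lambda>_of_nat_mult: "\<Lambda> d (of_nat n * f) = of_nat n * \<Lambda> d f"
  by (simp add: \<Lambda>_def of_nat_poly algebra_simps)

lemma \<Lambda>_V: "f \<in> B \<Longrightarrow> \<Lambda> d f \<in> V"
proof -
  assume "f \<in> B"
  then have "coeff (coeff f (p ^ d - 1)) (p ^ d)
    + of_int (- int p) * coeff (coeff f (p ^ Suc d + p ^ d - 1)) 0 \<in> V"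
    by (intro add_V mult_V coeff_B Ints_V) auto
  then show ?thesis by (simp add: \<Lambda>_def)
qed

section \<open>The functional on multiples of the generators\<close>

lemma coeff_X_power_mult: "coeff (coeff (X ^ n * f) i) j = (if i < n then 0 else coeff (coeff f (i - n)) j)"
  by (simp add: X_power_eq coeff_monom_mult)

lemma coeff_Y_power_mult: "coeff (coeff (Y ^ n * f) i) j = (if j < n then 0 else coeff (coeff f i) (j - n))"
  by (simp add: Y_power_eq coeff_monom_mult)

text \<open>The first monomial has X-degree p^d - 1, too small to occur, so only the coefficient
  weighted by - p survives.\<close>

lemma \<Lambda>_X_power_lower: "\<Lambda> d (X ^ (p ^ d) * f) = of_nat p * - coeff (coeff f (p ^ Suc d - 1)) 0"
proof -
  have "0 < p ^ d" "0 < p ^ Suc d" using prime_gt_0_nat[OF prime_p] by auto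
  then have "p ^ d - 1 < p ^ d" "\<not> p ^ Suc d + p ^ d - 1 < p ^ d"
    "p ^ Suc d + p ^ d - 1 - p ^ d = p ^ Suc d - 1" by linarith+
  then show ?thesis unfolding \<Lambda>_def coeff_X_power_mult by simp
qed

lemma \<Lambda>_X_power: "\<Lambda> d (X ^ (p ^ Suc d) * f) = - of_nat p * coeff (coeff f (p ^ d - 1)) 0"
proof -
  have "0 < p ^ d" "p ^ d \<le> p ^ Suc d" using prime_gt_0_nat[OF prime_p] by auto
  then have "p ^ d - 1 < p ^ Suc d" "\<not> p ^ Suc d + p ^ d - 1 < p ^ Suc d"
    "p ^ Suc d + p ^ d - 1 - p ^ Suc d = p ^ d - 1" by linarith+
  then show ?thesis unfolding \<Lambda>_def coeff_X_power_mult by simp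
qed

text \<open>The second monomial is free of Y, so only the first coefficient survives.\<close>

lemma \<Lambda>_Y_power: "\<Lambda> d (Y ^ (p ^ d) * f) = coeff (coeff f (p ^ d - 1)) 0"
  using prime_gt_0_nat[OF prime_p] unfolding \<Lambda>_def coeff_Y_power_mult by simp

lemma \<Lambda>_Y_power_upper: "\<Lambda> d (Y ^ (p ^ Suc d) * f) = 0"
  using prime_gt_1_nat[OF prime_p] unfolding \<Lambda>_def coeff_Y_power_mult by simp

text \<open>Generators with k < d carry p^2 explicitly. The cases k = d and k = d + 1 use the
  congruences for \<Psi>^k X modulo p and p^2.\<close>

lemma \<Lambda>_I: "f \<in> I (Suc d) \<Longrightarrow> \<exists>v\<in>V. \<Lambda> d f = of_nat (p ^ 2) * v"
proof (induction rule: I.induct)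
  case (torsion k f)
  consider "k = Suc d" | "k = d" | "k + 2 \<le> Suc d" using torsion(1) by linarith
  then show ?case
  proof cases
    case 1
    obtain h where h: "h \<in> B" "(\<Psi> ^^ Suc d) X = X ^ (p ^ Suc d) + of_nat p * Y ^ (p ^ d) + of_nat (p ^ 2) * h"
      using funpow_\<Psi>_X_mod_p2 by blast
    have "f * (of_nat (p ^ (Suc d - k)) * (\<Psi> ^^ k) X)
      = X ^ (p ^ Suc d) * f + of_nat p * (Y ^ (p ^ d) * f) + of_nat (p ^ 2) * (h * f)"
      unfolding 1 h(2) by (simp only: diff_self_eq_0 power_0 of_nat_1 mult_1 distrib_left mult_ac)
    \<comment> \<open>The terms from X^(p^(d+1)) and p Y^(p^d) are - p and + p times the same
      coefficient of f, and cancel.\<close>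
    then have "\<Lambda> d (f * (of_nat (p ^ (Suc d - k)) * (\<Psi> ^^ k) X)) = of_nat (p ^ 2) * \<Lambda> d (h * f)"
      by (simp add: \<Lambda>_add \<Lambda>_of_nat_mult \<Lambda>_X_power \<Lambda>_Y_power del: of_nat_power power_Suc)
    then show ?thesis using \<Lambda>_V mult_B[OF h(1) torsion(2)] by blast
  next
    case 2
    obtain h where h: "h \<in> B" "(\<Psi> ^^ d) X = X ^ (p ^ d) + of_nat p * h"
      using funpow_\<Psi>_X_mod_p by blast
    have "f * (of_nat (p ^ (Suc d - k)) * (\<Psi> ^^ k) X) = of_nat p * (X ^ (p ^ d) * f + of_nat p * (h * f))"
    proof -
      have "Suc d - k = 1" using 2 by simp
      then show ?thesis unfolding 2 h(2) by (simp only: power_one_right distrib_left mult_ac)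
    qed
    \<comment> \<open>One factor p comes from the generator; the second comes from the weight of
      \<Lambda> on the X-power and from p h in the remainder.\<close>
    then have "\<Lambda> d (f * (of_nat (p ^ (Suc d - k)) * (\<Psi> ^^ k) X))
      = of_nat (p ^ 2) * (of_int (- 1) * coeff (coeff f (p ^ Suc d - 1)) 0 + \<Lambda> d (h * f))"
      by (simp only: \<Lambda>_add \<Lambda>_of_nat_mult \<Lambda>_X_power_lower) (simp add: power2_eq_square algebra_simps)
    moreover have "of_int (- 1) * coeff (coeff f (p ^ Suc d - 1)) 0 + \<Lambda> d (h * f) \<in> V"
      by (intro add_V mult_V Ints_V coeff_B \<Lambda>_V mult_B h torsion Ints_of_int)
    ultimately show ?thesis by blast
  next
    case 3
    then have "Suc d - k = 2 + (Suc d - k - 2)" by linarith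
    then have "p ^ (Suc d - k) = p ^ 2 * p ^ (Suc d - k - 2)" by (metis power_add)
    then have "f * (of_nat (p ^ (Suc d - k)) * (\<Psi> ^^ k) X)
      = of_nat (p ^ 2) * (of_nat (p ^ (Suc d - k - 2)) * (f * (\<Psi> ^^ k) X))"
      by (simp only: of_nat_mult mult_ac)
    moreover have "of_nat (p ^ (Suc d - k - 2)) * (f * (\<Psi> ^^ k) X) \<in> B"
      by (intro mult_B of_nat_B torsion funpow_\<Psi>_B B.X)
    ultimately show ?thesis using \<Lambda>_V by (metis \<Lambda>_of_nat_mult)
  qed
next
  case (Y_power f)
  have "\<Lambda> d (f * Y ^ (p ^ Suc d)) = 0" using \<Lambda>_Y_power_upper by (simp only: mult.commute)
  then show ?case using Ints_V[OF Ints_0] by (metis mult_zero_right)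
next
  case (add f g)
  then show ?case by (metis \<Lambda>_add add_V distrib_left)
qed

text \<open>The power is the second monomial of \<Lambda>, with value - p. Membership would make
  this p^2 v with v in \<open>V\<close>, forcing 1/p into \<open>V\<close>.\<close>

lemma X_power_notin_I: "X ^ (p ^ Suc d + p ^ d - 1) \<notin> I (Suc d)"
proof
  assume "X ^ (p ^ Suc d + p ^ d - 1) \<in> I (Suc d)"
  then obtain v where v: "v \<in> V" "\<Lambda> d (X ^ (p ^ Suc d + p ^ d - 1)) = of_nat (p ^ 2) * v"
    using \<Lambda>_I by blast
  have p: "p > 0" using prime_gt_0_nat[OF prime_p] .
  then have "0 < p ^ d" "p ^ d \<le> p ^ Suc d" by auto
  then have "p ^ d - 1 < p ^ Suc d + p ^ d - 1" by linarith
  then have "\<Lambda> d (X ^ (p ^ Suc d + p ^ d - 1) * 1) = - of_nat p"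
    unfolding \<Lambda>_def coeff_X_power_mult by (simp add: coeff_1)
  with v(2) have "of_nat p * (of_nat p * v) = of_nat p * - 1" by (simp add: power2_eq_square)
  then have "of_nat p * v = - 1" using p by (simp only: mult_cancel_left) simp
  then have "1 / of_nat p = of_int (- 1) * v" using p by (simp add: field_simps)
  then have "1 / of_nat p \<in> V" using mult_V[OF Ints_V[OF Ints_of_int] v(1)] by metis
  then show False using inverse_p_notin_V by simp
qed

end

theorem mainTheorem3:
  fixes p e :: nat
  assumes "prime p" and "e \<ge> 1"
  shows "\<exists>(A :: nat ring) \<theta> a. lambda_ring A \<theta> \<and> a \<in> carrier A \<and>
    [(p ^ e)] \<cdot>\<^bsub>A\<^esub> a = \<zero>\<^bsub>A\<^esub> \<and> a [^]\<^bsub>A\<^esub> (p ^ e + p ^ (e - 1) - 1) \<noteq> \<zero>\<^bsub>A\<^esub>"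
proof -
  obtain d where e: "e = Suc d" using assms(2) by (cases e) auto
  interpret twisted_frobenius p by unfold_locales (rule assms)
  interpret adams_quotient c \<psi> B "I e" by (rule adams_quotient)
  show ?thesis
  proof (rule quotient_lambda_ring)
    show "X \<in> B" by (rule B.X)
    \<comment> \<open>This is the torsion generator with k = 0 and factor 1.\<close>
    show "of_nat (p ^ e) * X \<in> I e" using I.torsion[of 0 e 1] one_B by simp
    show "X ^ (p ^ e + p ^ (e - 1) - 1) \<notin> I e" unfolding e diff_Suc_1 by (rule X_power_notin_I)
  qed
qed

end
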